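(* Suppose that $0<\lambda\le\frac12$ and $H\in\mathcal{U}_2(\lambda)$. Let $F=H+\overline{G}$ be a harmonic mapping in $\mathbb{D}$, where $G$ is analytic in $\mathbb{D}$ with $G(0)=0$, and whose dilatation $\omega(z)=\frac{G'(z)}{H'(z)}$ satisfies $\omega(0)=0$ and $$|\omega(z)|\le\sqrt{(1-\lambda^2)(1-4\lambda^2)^2}\qquad\text{for all } z\in\mathbb{D}.$$ Then $F$ is sense-preserving and close-to-convex (univalent) in $\mathbb{D}$.
   Context: $\mathbb{D}=\{z\in\mathbb{C}:|z|<1\}$. $\mathcal{A}$ is the family of analytic functions $f$ in $\mathbb{D}$ with $f(0)=0=f'(0)-1$. For $0<\lambda\le1$, $\mathcal{U}(\lambda)$ is the set of $f\in\mathcal{A}$ with $\left|\left(\frac{z}{f(z)}\right)^2f'(z)-1\right|<\lambda$ for all $z\in\mathbb{D}$ (in particular $f$ does not vanish in $\mathbb{D}\setminus\{0\}$, and $z/f(z)$ is understood to be $1$ at $z=0$). $\mathcal{U}_2(\lambda)=\{f\in\mathcal{U}(\lambda): f''(0)=0\}$; functions in $\mathcal{U}(\lambda)$ are univalent, so $H'\ne0$ in $\mathbb{D}$. A harmonic mapping $F=H+\overline{G}$ ($H,G$ analytic) is sense-preserving if its Jacobian $J_F=|H'|^2-|G'|^2$ is positive in $\mathbb{D}$. A harmonic mapping $F$ is close-to-convex in $\mathbb{D}$ if it is univalent (injective) in $\mathbb{D}$ and the complement $D=\mathbb{C}\setminus F(\mathbb{D})$ can be filled with non-intersecting half-lines emanating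 on the boundary $\partial D$ and lying completely in $D$. *)

theory Defs
  imports "HOL-Complex_Analysis.Complex_Analysis"
begin

abbreviation unit_disc :: "complex set" where
  "unit_disc \<equiv> ball 0 1"

definition class_A :: "(complex \<Rightarrow> complex) set" where
  "class_A = {f. f holomorphic_on unit_disc \<and> f 0 = 0 \<and> deriv f 0 = 1}"

(* z / f(z), extended by its limit 1 over the removable singularity at 0. *)
definition z_over :: "(complex \<Rightarrow> complex) \<Rightarrow> complex \<Rightarrow> complex" where
  "z_over f z = (if z = 0 then 1 else z / f z)"

(* The second conjunct only makes the quotient meaningful; for lam \<le> 1 it follows from
   the third, since z / 0 = 0 would turn the left-hand side of the inequality into 1. *)
definition class_U :: "real \<Rightarrow> (complex \<Rightarrow> complex) set" where
  "class_U lam = {f. f \<in> class_A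
     \<and> (\<forall>z \<in> unit_disc - {0}. f z \<noteq> 0)
     \<and> (\<forall>z \<in> unit_disc. norm ((z_over f z)\<^sup>2 * deriv f z - 1) < lam)}"

definition class_U2 :: "real \<Rightarrow> (complex \<Rightarrow> complex) set" where
  "class_U2 lam = {f \<in> class_U lam. deriv (deriv f) 0 = 0}"

definition harmonic_mapping :: "(complex \<Rightarrow> complex) \<Rightarrow> (complex \<Rightarrow> complex) \<Rightarrow> complex \<Rightarrow> complex" where
  "harmonic_mapping H G z = H z + cnj (G z)"

definition dilatation :: "(complex \<Rightarrow> complex) \<Rightarrow> (complex \<Rightarrow> complex) \<Rightarrow> complex \<Rightarrow> complex" where
  "dilatation H G z = deriv G z / deriv H z"

(* The Jacobian of the harmonic mapping with analytic part H and co-analytic part cnj G. *)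
definition harmonic_jacobian :: "(complex \<Rightarrow> complex) \<Rightarrow> (complex \<Rightarrow> complex) \<Rightarrow> complex \<Rightarrow> real" where
  "harmonic_jacobian H G z = (norm (deriv H z))\<^sup>2 - (norm (deriv G z))\<^sup>2"

definition sense_preserving :: "(complex \<Rightarrow> complex) \<Rightarrow> (complex \<Rightarrow> complex) \<Rightarrow> bool" where
  "sense_preserving H G \<longleftrightarrow> (\<forall>z \<in> unit_disc. harmonic_jacobian H G z > 0)"

definition half_line :: "complex \<Rightarrow> complex \<Rightarrow> complex set" where
  "half_line p v = {p + of_real t * v | t. t \<ge> 0}"

(* Half-lines are closed (they contain their origin), and distinct half-lines of the family
   have no point in common, origins included. *)
definition filled_by_half_lines :: "complex set \<Rightarrow> bool" where
  "filled_by_half_lines D \<longleftrightarrow>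
     (\<exists>\<R>. (\<forall>L \<in> \<R>. \<exists>p v. p \<in> frontier D \<and> v \<noteq> 0 \<and> L = half_line p v)
        \<and> disjoint \<R> \<and> \<Union>\<R> = D)"

definition close_to_convex :: "(complex \<Rightarrow> complex) \<Rightarrow> bool" where
  "close_to_convex F \<longleftrightarrow> inj_on F unit_disc \<and> filled_by_half_lines (- (F ` unit_disc))"

end

theory Submission imports Defs begin

text \<open>
  The bound on \<open>H\<close> gives \<open>z / H z\<close> and \<open>(z / H z)\<^sup>2 H' z\<close> in the open disc of radius \<open>lam\<close>
  about 1, so the argument of \<open>H'\<close> is smaller than \<open>3 arcsin lam \<le> \<pi>/2\<close>. The bound on the
  dilatation is exactly \<open>cos (3 arcsin lam)\<close>, whence \<open>Re H' > \<bar>G'\<bar>\<close>. Thus \<open>F = H + cnj G\<close>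
  extends to a strictly monotone map of the closed disc, i.e. the inner product of
  \<open>F x - F y\<close> with \<open>x - y\<close> is positive for \<open>x \<noteq> y\<close>. Extending further by
  \<open>F (r \<zeta>) = F \<zeta> + (r - 1) \<zeta>\<close> for \<open>\<bar>\<zeta>\<bar> = 1 \<le> r\<close> keeps injectivity, and invariance of
  domain makes this extension a bijection of the plane. So the half-lines starting at \<open>F \<zeta>\<close> in
  direction \<open>\<zeta>\<close> fill the complement of the image of the disc.
\<close>

section \<open>Monotone maps of the closed ball\<close>

text \<open>Nearest-point projection onto the closed unit ball. The \<open>max\<close> spares a case
  split and keeps the divisor away from zero, so continuity is immediate.\<close>

definition ball_proj :: "'a::real_normed_vector \<Rightarrow> 'a" where
  "ball_proj x = x /\<^sub>R max 1 (norm x)"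

lemma norm_ball_proj_le: "norm (ball_proj x) \<le> 1"
  by (auto simp: ball_proj_def max_def divide_simps)

lemma ball_proj_id: "norm x \<le> 1 \<Longrightarrow> ball_proj x = x"
  by (simp add: ball_proj_def max_def)

lemma ball_proj_unit: "norm x = 1 \<Longrightarrow> r \<ge> 1 \<Longrightarrow> ball_proj (r *\<^sub>R x) = x"
  by (simp add: ball_proj_def max_def)

lemma continuous_on_ball_proj: "continuous_on S ball_proj"
  unfolding ball_proj_def[abs_def] by (intro continuous_intros) auto

text \<open>The obtuse-angle property of the nearest point: outside the ball
  \<open>x - ball_proj x\<close> is a positive multiple of the unit vector
  \<open>ball_proj x\<close>, and Cauchy-Schwarz compares its inner products with \<open>y\<close>
  and with itself.\<close>

lemma inner_ball_proj_le:
  fixes x y :: "'a::real_inner"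
  assumes "norm y \<le> 1"
  shows "inner (x - ball_proj x) (y - ball_proj x) \<le> 0"
proof (cases "norm x \<le> 1")
  case True
  then show ?thesis by (simp add: ball_proj_id)
next
  case False
  define u where "u = ball_proj x"
  have u: "norm u = 1" "x = norm x *\<^sub>R u"
    using False by (auto simp: u_def ball_proj_def max_def field_simps)
  have "inner u y \<le> 1"
    using norm_cauchy_schwarz[of u y] u(1) assms by simp
  moreover have "x - u = (norm x - 1) *\<^sub>R u"
    using u(2) by (metis scaleR_left_diff_distrib scaleR_one)
  moreover have "inner u u = 1" using u(1) by (simp add: dot_square_norm)
  ultimately show ?thesis
    using False unfolding u_def[symmetric]
    by (auto simp: inner_diff_right mult_le_0_iff)
qed

section \<open>Extending a strictly monotone map of the ball to the whole space\<close>

definition radial_extension :: "('a::real_normed_vector \<Rightarrow> 'a) \<Rightarrow> 'a \<Rightarrow> 'a" where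
  "radial_extension f x = f (ball_proj x) + (x - ball_proj x)"

text \<open>Equal values turn \<open>f p - f q\<close>, for the projections \<open>p\<close> and
  \<open>q\<close>, into \<open>(y - q) - (x - p)\<close>. Pairing this with \<open>p - q\<close>
  and using the obtuse angles at \<open>p\<close> and \<open>q\<close> gives a nonpositive number,
  so strict monotonicity forces \<open>p = q\<close>.\<close>

lemma inj_radial_extension:
  fixes f :: "'a::real_inner \<Rightarrow> 'a"
  assumes mono: "\<And>x y. \<lbrakk>x \<in> cball 0 1; y \<in> cball 0 1; x \<noteq> y\<rbrakk> \<Longrightarrow> inner (f x - f y) (x - y) > 0"
  shows "inj (radial_extension f)"
proof (rule injI)
  fix x y :: 'a
  assume eq: "radial_extension f x = radial_extension f y"
  define p q where "p = ball_proj x" and "q = ball_proj y"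
  have pq: "norm p \<le> 1" "norm q \<le> 1"
    by (auto simp: p_def q_def norm_ball_proj_le)
  have fpq: "f p - f q = (y - q) - (x - p)"
    using eq by (simp add: radial_extension_def p_def q_def algebra_simps)
  have "inner (x - p) (q - p) \<le> 0" "inner (y - q) (p - q) \<le> 0"
    using pq inner_ball_proj_le by (auto simp: p_def q_def)
  then have "inner (f p - f q) (p - q) \<le> 0"
    unfolding fpq by (simp add: inner_diff_left inner_diff_right)
  with mono[of p q] pq have "p = q" by force
  with eq show "x = y" by (simp add: radial_extension_def p_def q_def)
qed

text \<open>The range is open by invariance of domain and closed because the extension is proper, so
  by connectedness it is everything.\<close>

lemma surj_radial_extension:
  fixes f :: "'a::euclidean_space \<Rightarrow> 'a"
  assumes cont: "continuous_on (cball 0 1) f"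
    and mono: "\<And>x y. \<lbrakk>x \<in> cball 0 1; y \<in> cball 0 1; x \<noteq> y\<rbrakk> \<Longrightarrow> inner (f x - f y) (x - y) > 0"
  shows "surj (radial_extension f)"
proof -
  let ?g = "radial_extension f"
  have contg: "continuous_on S ?g" for S
    unfolding radial_extension_def[abs_def]
    by (intro continuous_intros continuous_on_ball_proj
        continuous_on_compose2[OF cont continuous_on_ball_proj])
      (auto simp: norm_ball_proj_le)
  have "open (range ?g)"
    by (intro invariance_of_domain contg inj_radial_extension mono) auto
  moreover have "closed (range ?g)"
  proof -
    have "compact (f ` cball 0 1)"
      by (intro compact_continuous_image cont) auto
    then obtain M where M: "\<And>x. x \<in> cball 0 1 \<Longrightarrow> norm (f x) \<le> M"
      by (meson bounded_iff compact_imp_bounded imageI)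
    \<comment> \<open>The extension differs from the identity by at most \<open>M + 1\<close>, so
      preimages of bounded sets are bounded.\<close>
    have bd: "norm x \<le> norm (?g x) + M + 1" for x
    proof -
      have "x = ?g x - f (ball_proj x) + ball_proj x"
        by (simp add: radial_extension_def)
      then have "norm x \<le> norm (?g x) + norm (f (ball_proj x)) + norm (ball_proj x)"
        by (metis norm_triangle_ineq norm_triangle_ineq4 add_right_mono order_trans)
      with M[of "ball_proj x"] norm_ball_proj_le[of x] show ?thesis by simp
    qed
    have "y \<in> range ?g" if y: "y \<in> closure (range ?g)" for y
    proof (rule ccontr)
      assume "y \<notin> range ?g"
      \<comment> \<open>By \<open>bd\<close>, every \<open>x\<close> whose value lies within 1 of
        \<open>y\<close> has norm at most \<open>(norm y + 1) + M + 1\<close>. Hence the compact set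
        \<open>K\<close> contains all values near \<open>y\<close>.\<close>
      define K where "K = ?g ` cball 0 (norm y + M + 2)"
      have "closed K"
        unfolding K_def by (intro compact_imp_closed compact_continuous_image contg) auto
      then have "open (ball y 1 - K)" by auto
      moreover have "y \<in> ball y 1 - K" using \<open>y \<notin> range ?g\<close> by (auto simp: K_def)
      ultimately obtain x where x: "?g x \<in> ball y 1" "?g x \<notin> K"
        using y open_Int_closure_eq_empty[of "ball y 1 - K" "range ?g"] by blast
      have "norm (?g x) \<le> norm y + 1"
        using x(1) norm_triangle_sub[of "?g x" y] by (simp add: dist_norm norm_minus_commute)
      with bd[of x] have "x \<in> cball 0 (norm y + M + 2)" by simp
      with x(2) show False by (auto simp: K_def)
    qed
    then show ?thesis by (meson closure_subset_eq subsetI)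
  qed
  ultimately show ?thesis
    using clopen[of "range ?g"] by auto
qed

text \<open>The radial rays starting on the unit circle partition the complement of the open disc.
  The extension is a bijection of the plane that maps each ray onto a half-line, so the half-lines
  partition the complement of the image.\<close>

lemma close_to_convex_if_monotone:
  fixes F f :: "complex \<Rightarrow> complex"
  assumes cont: "continuous_on (cball 0 1) f"
    and mono: "\<And>x y. \<lbrakk>x \<in> cball 0 1; y \<in> cball 0 1; x \<noteq> y\<rbrakk> \<Longrightarrow> inner (f x - f y) (x - y) > 0"
    and ext: "\<And>x. x \<in> unit_disc \<Longrightarrow> F x = f x"
  shows "close_to_convex F"
proof -
  let ?g = "radial_extension f"
  have inj: "inj ?g" using mono by (rule inj_radial_extension)
  have surj: "surj ?g" using cont mono by (rule surj_radial_extension)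
  have gf: "?g x = f x" if "norm x \<le> 1" for x
    using that by (simp add: radial_extension_def ball_proj_id)
  have gout: "?g ((1 + t) *\<^sub>R u) = f u + of_real t * u" if "norm u = 1" "t \<ge> 0" for t u
    using that ball_proj_unit[of u "1 + t"]
    by (simp add: radial_extension_def scaleR_conv_of_real algebra_simps)
  have img: "F ` unit_disc = ?g ` unit_disc"
    by (intro image_cong) (auto simp: ext gf)
  have compl: "- (F ` unit_disc) = ?g ` (- unit_disc)"
    unfolding img using bij_image_Compl_eq[of ?g unit_disc] inj surj by (simp add: bij_def)
  let ?\<R> = "(\<lambda>u. half_line (f u) u) ` sphere 0 1"
  have "inj_on F unit_disc"
    using inj by (auto simp: inj_on_def ext gf[symmetric])
  moreover have "filled_by_half_lines (- (F ` unit_disc))"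
    unfolding filled_by_half_lines_def
  proof (intro exI[of _ ?\<R>] conjI ballI)
    fix L assume "L \<in> ?\<R>"
    then obtain u where u: "norm u = 1" "L = half_line (f u) u" by auto
    \<comment> \<open>The origin of each half-line is a limit of values of \<open>F\<close>, but by
      injectivity of the extension it is not itself such a value; hence it is a frontier
      point.\<close>
    have "f u \<in> closure (F ` unit_disc)"
    proof -
      have "u \<in> closure unit_disc" using u by simp
      moreover have "f ` closure unit_disc \<subseteq> closure (f ` unit_disc)"
        by (rule image_closure_subset) (use cont closure_subset[of "f ` unit_disc"] in auto)
      moreover have "f ` unit_disc = F ` unit_disc"
        by (intro image_cong) (auto simp: ext)
      ultimately show ?thesis by auto
    qed
    moreover have "f u \<in> - (F ` unit_disc)"
      unfolding compl using gf[of u] u by (intro image_eqI[of _ _ u]) auto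
    ultimately have "f u \<in> frontier (- (F ` unit_disc))"
      using interior_subset[of "F ` unit_disc"] by (simp add: frontier_complement) (auto simp: frontier_def)
    moreover have "u \<noteq> 0" using u by auto
    ultimately show "\<exists>p v. p \<in> frontier (- (F ` unit_disc)) \<and> v \<noteq> 0 \<and> L = half_line p v"
      using u by blast
  next
    \<comment> \<open>A common point has the preimages \<open>(1 + s) u\<close> and
      \<open>(1 + t) v\<close>; these coincide, and comparing norms and then directions gives
      \<open>u = v\<close>.\<close>
    have uniq: "u = v" if uv: "norm u = 1" "norm v = 1" "x \<in> half_line (f u) u" "x \<in> half_line (f v) v"
      for u v x
    proof -
      obtain s t where st: "s \<ge> 0" "t \<ge> 0" "x = f u + of_real s * u" "x = f v + of_real t * v"
        using uv(3,4) unfolding half_line_def by blast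
      then have "?g ((1 + s) *\<^sub>R u) = ?g ((1 + t) *\<^sub>R v)"
        using uv gout by metis
      then have eq: "(1 + s) *\<^sub>R u = (1 + t) *\<^sub>R v" using inj by (simp add: inj_eq)
      then have "norm ((1 + s) *\<^sub>R u) = norm ((1 + t) *\<^sub>R v)" by (rule arg_cong)
      then have "s = t" using uv st by simp
      with eq st show "u = v" by auto
    qed
    show "disjoint ?\<R>"
      unfolding disjoint_def using uniq by (auto; blast)
    show "\<Union> ?\<R> = - (F ` unit_disc)"
    proof (intro subset_antisym subsetI)
      fix x assume "x \<in> \<Union> ?\<R>"
      then obtain u t where ut: "norm u = 1" "t \<ge> 0" "x = f u + of_real t * u"
        by (auto simp: half_line_def)
      then show "x \<in> - (F ` unit_disc)"
        unfolding compl by (intro image_eqI[of _ _ "(1 + t) *\<^sub>R u"]) (simp_all only: gout, auto)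
    next
      fix x assume "x \<in> - (F ` unit_disc)"
      then obtain y where "y \<in> - unit_disc" "x = ?g y" unfolding compl by blast
      then have y: "norm y \<ge> 1" "x = ?g y" by auto
      then have u: "norm (sgn y) = 1" by (auto simp: norm_sgn)
      have "(1 + (norm y - 1)) *\<^sub>R sgn y = y"
      proof -
        have "y \<noteq> 0" using y(1) by auto
        then show ?thesis by (simp add: sgn_div_norm)
      qed
      then have "x = f (sgn y) + of_real (norm y - 1) * sgn y"
        using gout[OF u, of "norm y - 1"] y by (simp only: diff_ge_0_iff_ge)
      then have "x \<in> half_line (f (sgn y)) (sgn y)"
        using y(1) by (auto simp: half_line_def intro!: exI[of _ "norm y - 1"])
      then show "x \<in> \<Union> ?\<R>" using u by auto
    qed
  qed
  ultimately show ?thesis by (simp add: close_to_convex_def)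
qed

section \<open>The argument of the derivative\<close>

text \<open>The tangents from the origin to the circle of radius \<open>l\<close> about 1 make the
  angle \<open>arcsin l\<close> with the real axis. Algebraically, \<open>norm (w - 1) < l\<close>
  bounds \<open>Re w\<close> below by a mean of \<open>(norm w)^2\<close> and
  \<open>1 - l^2\<close>, and the AM-GM inequality converts this into a bound on the sine of the
  argument.\<close>

lemma abs_Arg_less_arcsin:
  assumes "norm (w - 1) < l" "l \<le> 1"
  shows "\<bar>Arg w\<bar> < arcsin l"
proof -
  have l: "0 < l" using assms(1) norm_ge_zero order.strict_trans1 by blast
  have re: "Re w > 0"
    using abs_Re_le_cmod[of "w - 1"] assms by simp
  then have "w \<noteq> 0" by auto
  have a: "\<bar>Arg w\<bar> < pi / 2" using Arg_Re_pos re by simp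
  have im: "Im w = norm w * sin (Arg w)"
    by (metis Im_rcis rcis_cmod_Arg)
  have "(norm (w - 1))\<^sup>2 < l\<^sup>2" using assms(1) by (intro power_strict_mono) auto
  then have "((norm w)\<^sup>2 + (1 - l\<^sup>2)) / 2 < Re w"
    unfolding cmod_power2 by (simp add: power2_eq_square algebra_simps)
  moreover have "0 \<le> ((norm w)\<^sup>2 + (1 - l\<^sup>2)) / 2"
    using l assms(2) by (simp add: power_le_one)
  ultimately have "(((norm w)\<^sup>2 + (1 - l\<^sup>2)) / 2)\<^sup>2 < (Re w)\<^sup>2"
    by (intro power_strict_mono) auto
  moreover have "(norm w)\<^sup>2 * (1 - l\<^sup>2) \<le> (((norm w)\<^sup>2 + (1 - l\<^sup>2)) / 2)\<^sup>2"
    using sum_squares_bound[of "(norm w)\<^sup>2" "1 - l\<^sup>2"]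
    by (simp add: power2_eq_square algebra_simps)
  ultimately have "(Im w)\<^sup>2 < (l * norm w)\<^sup>2"
    by (simp add: cmod_power2 algebra_simps power_mult_distrib)
  then have "\<bar>Im w\<bar> < l * norm w"
    using l abs_le_square_iff[of "l * norm w" "Im w"] by (simp add: not_le[symmetric])
  then have s: "\<bar>sin (Arg w)\<bar> < l"
    using \<open>w \<noteq> 0\<close> unfolding im by (simp add: abs_mult mult.commute)
  \<comment> \<open>Here \<open>arcsin\<close> inverts \<open>sin\<close> because
    \<open>Re w > 0\<close> keeps \<open>Arg w\<close> within a right angle of 0.\<close>
  have "arcsin (sin (Arg w)) < arcsin l" "arcsin (- l) < arcsin (sin (Arg w))"
    using s assms(2) by (intro arcsin_less_arcsin; simp)+
  then show ?thesis
    using a s l assms(2) by (simp add: arcsin_sin arcsin_minus abs_less_iff)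
qed

lemma cos_3_arcsin:
  assumes "\<bar>l\<bar> \<le> 1"
  shows "cos (3 * arcsin l) = sqrt (1 - l\<^sup>2) * (1 - 4 * l\<^sup>2)"
proof -
  have "cos (arcsin l) ^ 3 = cos (arcsin l) * (1 - l\<^sup>2)"
    using assms by (simp add: cos_arcsin power3_eq_cube abs_square_le_1)
  then show ?thesis
    using assms unfolding cos_treble_cos by (simp add: cos_arcsin algebra_simps)
qed

text \<open>The argument of \<open>q / p^2\<close> is \<open>a - 2 b\<close>, of size below
  \<open>3 arcsin l\<close>, which is at most a right angle because \<open>l\<close> is at most
  \<open>sin (pi / 6)\<close>. The factor in front is the cosine of
  \<open>3 arcsin l\<close>.\<close>

lemma Re_quotient_gt:
  assumes p: "norm (p - 1) < l" and q: "norm (q - 1) < l" and l: "l \<le> 1 / 2"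
  shows "sqrt ((1 - l\<^sup>2) * (1 - 4 * l\<^sup>2)\<^sup>2) * norm (q / p\<^sup>2) < Re (q / p\<^sup>2)"
proof -
  define a b where "a = Arg q" and "b = Arg p"
  have l0: "0 < l" using p norm_ge_zero order.strict_trans1 by blast
  have nz: "p \<noteq> 0" "q \<noteq> 0" using p q l by auto
  have ab: "\<bar>a\<bar> < arcsin l" "\<bar>b\<bar> < arcsin l"
    unfolding a_def b_def using p q l by (auto intro: abs_Arg_less_arcsin)
  have "arcsin l \<le> arcsin (sin (pi / 6))"
    using l l0 by (intro arcsin_le_arcsin) (auto simp: sin_30)
  then have t: "3 * arcsin l \<le> pi / 2" by (simp add: arcsin_sin)
  have "q = rcis (norm q) a" "p = rcis (norm p) b"
    by (simp_all add: a_def b_def rcis_cmod_Arg)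
  then have "q / p\<^sup>2 = rcis (norm q / (norm p)\<^sup>2) (a - 2 * b)"
    by (metis DeMoivre2 of_nat_numeral rcis_divide)
  then have "Re (q / p\<^sup>2) = norm (q / p\<^sup>2) * cos \<bar>a - 2 * b\<bar>"
    by (simp add: norm_divide norm_power)
  moreover have "cos (3 * arcsin l) < cos \<bar>a - 2 * b\<bar>"
    using ab t by (intro cos_monotone_0_pi) (auto intro: order_trans[OF t])
  moreover have "sqrt ((1 - l\<^sup>2) * (1 - 4 * l\<^sup>2)\<^sup>2) = cos (3 * arcsin l)"
  proof -
    \<comment> \<open>This makes \<open>1 - 4 l^2\<close> nonnegative, so the root of its square is
      the factor itself, without an absolute value.\<close>
    have "l\<^sup>2 \<le> (1 / 2)\<^sup>2" using l l0 by (intro power_mono) auto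
    then show ?thesis
      using l l0 by (simp add: cos_3_arcsin real_sqrt_mult power2_eq_square)
  qed
  ultimately show ?thesis using nz by (simp add: mult.commute)
qed

section \<open>Schwarz-type estimates for the class \<open>class_U2\<close>\<close>

text \<open>As in the Schwarz lemma: on the circle of radius \<open>r\<close> the hypothesis gives
  \<open>l / r^2\<close>, the maximum modulus principle carries this bound inside, and
  \<open>r\<close> tends to 1.\<close>

lemma norm_le_of_norm_sq_mult_le:
  assumes hol: "v holomorphic_on unit_disc"
    and le: "\<And>z. z \<in> unit_disc \<Longrightarrow> norm (z\<^sup>2 * v z) \<le> l"
    and z: "z \<in> unit_disc"
  shows "norm (v z) \<le> l"
proof -
  have bound: "norm (v z) * r\<^sup>2 \<le> l" if r: "norm z < r" "r < 1" for r
  proof -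
    have r0: "0 < r" using r norm_ge_zero order.strict_trans1 by blast
    have "norm (v z) \<le> l / r\<^sup>2"
    proof (rule maximum_modulus_frontier[of v "ball 0 r"])
      show "v holomorphic_on interior (ball 0 r)"
        using r by (intro holomorphic_on_subset[OF hol]) auto
      show "continuous_on (closure (ball 0 r)) v"
        using r r0 by (intro holomorphic_on_imp_continuous_on holomorphic_on_subset[OF hol]) auto
      fix w :: complex assume "w \<in> frontier (ball 0 r)"
      then have "norm w = r" using r0 by simp
      with le[of w] r r0 show "norm (v w) \<le> l / r\<^sup>2"
        by (simp add: norm_mult norm_power field_simps)
    qed (use r in auto)
    then show ?thesis using r0 by (simp add: field_simps)
  qed
  have "((\<lambda>r. norm (v z) * r\<^sup>2) \<longlongrightarrow> norm (v z) * 1\<^sup>2) (at_left 1)"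
    by (intro tendsto_intros)
  moreover have "\<forall>\<^sub>F r in at_left 1. norm (v z) * r\<^sup>2 \<le> l"
    using z by (intro eventually_at_leftI[of "norm z"] bound) auto
  ultimately show ?thesis
    using tendsto_upperbound[of "\<lambda>r. norm (v z) * r\<^sup>2"] by fastforce
qed

text \<open>Write \<open>z / f z = 1 + z u z\<close>. The vanishing second derivative gives
  \<open>u 0 = 0\<close>, and the defining inequality becomes a bound on \<open>z^2 u'\<close>.
  Hence \<open>u'\<close> is bounded by \<open>l\<close>, so \<open>u\<close> by
  \<open>l |z|\<close>, and \<open>z / f z - 1\<close> by \<open>l |z|^2\<close>.\<close>

lemma class_U2_z_over:
  assumes f: "f \<in> class_U2 l" and l: "0 < l" and z: "z \<in> unit_disc"
  shows "norm (z_over f z - 1) < l"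
proof -
  let ?p = "z_over f"
  have holf: "f holomorphic_on unit_disc" and f0: "f 0 = 0" "deriv f 0 = 1"
    and f2: "deriv (deriv f) 0 = 0"
    and nz: "\<And>z. z \<in> unit_disc - {0} \<Longrightarrow> f z \<noteq> 0"
    and U: "\<And>z. z \<in> unit_disc \<Longrightarrow> norm ((?p z)\<^sup>2 * deriv f z - 1) < l"
    using f by (auto simp: class_U2_def class_U_def class_A_def)
  \<comment> \<open>The quotient \<open>f z / z\<close> with its singularity at 0 removed; being
    zero-free, it makes its reciprocal \<open>z_over f\<close> holomorphic.\<close>
  define h where "h z = (if z = 0 then deriv f 0 else (f z - f 0) / (z - 0))" for z
  have holh: "h holomorphic_on unit_disc"
    unfolding h_def[abs_def] by (rule pole_lemma[OF holf]) auto
  have hnz: "h z \<noteq> 0" if "z \<in> unit_disc" for z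
    using that nz[of z] by (auto simp: h_def f0)
  have p: "?p z = inverse (h z)" for z
    by (simp add: z_over_def h_def f0)
  have holp: "?p holomorphic_on unit_disc"
    unfolding p by (intro holomorphic_intros holh hnz)
  have dh: "(h has_field_derivative deriv h z) (at z)" if "z \<in> unit_disc" for z
    using holh that by (auto intro: holomorphic_derivI)
  have f_eq: "f z = z * h z" for z by (simp add: h_def f0)
  have deriv_f: "deriv f z = h z + z * deriv h z" if "z \<in> unit_disc" for z
  proof (rule DERIV_imp_deriv)
    show "(f has_field_derivative h z + z * deriv h z) (at z)"
      unfolding f_eq[abs_def] by (rule derivative_eq_intros dh that refl)+ simp
  qed
  \<comment> \<open>In Taylor coefficients: \<open>f z = z + h'(0) z^2 + ...\<close>, so the second
    derivative of \<open>f\<close> at 0 is twice \<open>h'(0)\<close>.\<close>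
  have "(deriv f has_field_derivative 2 * deriv h 0) (at 0)"
  proof -
    have "(deriv h has_field_derivative deriv (deriv h) 0) (at 0)"
      by (rule holomorphic_derivI[OF holomorphic_deriv[OF holh]]) auto
    then have "((\<lambda>z. h z + z * deriv h z) has_field_derivative 2 * deriv h 0) (at 0)"
      using dh[of 0] by (auto intro!: derivative_eq_intros)
    then show ?thesis
      by (rule has_field_derivative_transform_within_open[where S = unit_disc])
        (auto simp: deriv_f)
  qed
  then have dh0: "deriv h 0 = 0" using f2 DERIV_imp_deriv by fastforce
  have deriv_p: "deriv ?p z = - deriv h z / (h z)\<^sup>2" if "z \<in> unit_disc" for z
  proof (rule DERIV_imp_deriv)
    show "(?p has_field_derivative - deriv h z / (h z)\<^sup>2) (at z)"
      unfolding p[abs_def]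
      by (rule derivative_eq_intros dh that refl hnz)+
        (simp add: field_simps power2_eq_square)
  qed
  define u where "u z = (if z = 0 then deriv ?p 0 else (?p z - ?p 0) / (z - 0))" for z
  have holu: "u holomorphic_on unit_disc"
    unfolding u_def[abs_def] by (rule pole_lemma[OF holp]) auto
  have p0: "?p 0 = 1" by (simp add: z_over_def)
  have u0: "u 0 = 0" by (simp add: u_def deriv_p dh0)
  have p_eq: "?p z = 1 + z * u z" for z by (simp add: u_def p0)
  have du: "(u has_field_derivative deriv u z) (at z)" if "z \<in> unit_disc" for z
    using holu that by (auto intro: holomorphic_derivI)
  have deriv_p': "deriv ?p z = u z + z * deriv u z" if "z \<in> unit_disc" for z
  proof (rule DERIV_imp_deriv)
    show "(?p has_field_derivative u z + z * deriv u z) (at z)"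
      unfolding p_eq[abs_def] by (rule derivative_eq_intros du that refl)+ simp
  qed
  \<comment> \<open>With \<open>p = z / f\<close>, the quotient rule gives
    \<open>p^2 f' = p - z p'\<close>, and inserting \<open>p = 1 + z u\<close> cancels the terms in
    \<open>u\<close> itself.\<close>
  have key: "z\<^sup>2 * deriv u z = 1 - (?p z)\<^sup>2 * deriv f z" if z: "z \<in> unit_disc" for z
  proof -
    have "(?p z)\<^sup>2 * deriv f z = ?p z - z * deriv ?p z"
      using hnz[OF z] by (simp add: p deriv_f[OF z] deriv_p[OF z] field_simps power2_eq_square)
    also have "\<dots> = 1 - z\<^sup>2 * deriv u z"
      by (simp add: deriv_p'[OF z] p_eq power2_eq_square algebra_simps)
    finally show ?thesis by simp
  qed
  have "norm (deriv u w) \<le> l" if "w \<in> unit_disc" for w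
  proof (rule norm_le_of_norm_sq_mult_le[OF _ _ that])
    show "deriv u holomorphic_on unit_disc" using holu by (rule holomorphic_deriv) auto
    show "norm (z\<^sup>2 * deriv u z) \<le> l" if "z \<in> unit_disc" for z
      using U[OF that] by (simp add: key[OF that] norm_minus_commute)
  qed
  then have "norm (u z - u 0) \<le> l * norm (z - 0)"
    using z by (intro field_differentiable_bound[where S = unit_disc and f' = "deriv u"])
      (auto intro!: DERIV_subset[OF du])
  then have "norm (?p z - 1) \<le> l * (norm z)\<^sup>2"
    using mult_left_mono[of "norm (u z)" "l * norm z" "norm z"]
    by (simp add: p_eq u0 norm_mult power2_eq_square algebra_simps)
  also have "\<dots> < l"
    using l z by (simp add: power_less_one_iff abs_square_less_1)
  finally show ?thesis .
qed

text \<open>Both bounds come from \<open>f' = q / p^2\<close> with \<open>p\<close> and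
  \<open>q\<close> in the disc of radius \<open>l\<close> about 1. The crude constant 6 is
  \<open>(3/2) / (1/2)^2\<close>; it serves to make the harmonic mapping Lipschitz.\<close>

lemma class_U2_deriv_bounds:
  assumes f: "f \<in> class_U2 l" and l: "0 < l" "l \<le> 1 / 2" and z: "z \<in> unit_disc"
  shows "sqrt ((1 - l\<^sup>2) * (1 - 4 * l\<^sup>2)\<^sup>2) * norm (deriv f z) < Re (deriv f z)"
    and "norm (deriv f z) \<le> 6"
proof -
  define p q where "p = z_over f z" and "q = (z_over f z)\<^sup>2 * deriv f z"
  have p: "norm (p - 1) < l" unfolding p_def using f l(1) z by (rule class_U2_z_over)
  have q: "norm (q - 1) < l"
    using f z by (simp add: q_def class_U2_def class_U_def)
  have p2: "1 / 2 \<le> norm p"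
    using p l norm_triangle_ineq2[of 1 p] by (simp add: norm_minus_commute)
  then have eq: "deriv f z = q / p\<^sup>2" by (auto simp: p_def q_def)
  show "sqrt ((1 - l\<^sup>2) * (1 - 4 * l\<^sup>2)\<^sup>2) * norm (deriv f z) < Re (deriv f z)"
    unfolding eq using p q l(2) by (rule Re_quotient_gt)
  have "norm q \<le> 6 * (1 / 2)\<^sup>2"
    using q l norm_triangle_sub[of q 1] by (simp add: power2_eq_square)
  also have "\<dots> \<le> 6 * (norm p)\<^sup>2"
    using p2 by (intro mult_left_mono power_mono) auto
  finally show "norm (deriv f z) \<le> 6"
    using p2 by (simp add: eq norm_divide norm_power divide_simps)
qed

section \<open>Harmonic mappings\<close>

text \<open>A Noshiro-Warschawski argument: along a segment of direction \<open>d\<close>, the inner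
  product of \<open>F\<close> with \<open>d\<close> has derivative at least
  \<open>|d|^2 (Re H' - |G'|) > 0\<close>. The bound \<open>B\<close> provides the continuous
  extension to the closed disc.\<close>

lemma close_to_convex_harmonic_mapping:
  assumes holH: "H holomorphic_on unit_disc" and holG: "G holomorphic_on unit_disc"
    and less: "\<And>z. z \<in> unit_disc \<Longrightarrow> norm (deriv G z) < Re (deriv H z)"
    and bound: "\<And>z. z \<in> unit_disc \<Longrightarrow> norm (deriv H z) \<le> B"
  shows "close_to_convex (harmonic_mapping H G)"
proof -
  let ?F = "harmonic_mapping H G"
  have dH: "(H has_field_derivative deriv H z) (at z)" if "z \<in> unit_disc" for z
    using holH that by (auto intro: holomorphic_derivI)
  have dG: "(G has_field_derivative deriv G z) (at z)" if "z \<in> unit_disc" for z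
    using holG that by (auto intro: holomorphic_derivI)
  have boundG: "norm (deriv G z) \<le> B" if "z \<in> unit_disc" for z
    using less[OF that] bound[OF that] abs_Re_le_cmod[of "deriv H z"] by linarith
  have "(2 * B)-lipschitz_on unit_disc ?F"
  proof (rule lipschitz_onI)
    show "0 \<le> 2 * B" using order_trans[OF norm_ge_zero bound[of 0]] by simp
    fix x y assume xy: "x \<in> unit_disc" "y \<in> unit_disc"
    have "norm (H x - H y) \<le> B * norm (x - y)"
      using xy bound by (intro field_differentiable_bound[where S = unit_disc and f' = "deriv H"])
        (auto intro!: DERIV_subset[OF dH])
    moreover have "norm (G x - G y) \<le> B * norm (x - y)"
      using xy boundG by (intro field_differentiable_bound[where S = unit_disc and f' = "deriv G"])
        (auto intro!: DERIV_subset[OF dG])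
    moreover have "?F x - ?F y = (H x - H y) + cnj (G x - G y)"
      by (simp add: harmonic_mapping_def)
    then have "norm (?F x - ?F y) \<le> norm (H x - H y) + norm (G x - G y)"
      by (metis complex_mod_cnj norm_triangle_ineq)
    ultimately show "dist (?F x) (?F y) \<le> 2 * B * dist x y"
      by (simp add: dist_norm)
  qed
  then obtain f where "(2 * B)-lipschitz_on (closure unit_disc) f"
    and f: "\<And>x. x \<in> unit_disc \<Longrightarrow> f x = ?F x"
    using lipschitz_extend_closure by metis
  then have cont: "continuous_on (cball 0 1) f"
    by (simp add: lipschitz_on_continuous_on)
  have mono: "inner (f x - f y) (x - y) > 0"
    if xy: "x \<in> cball 0 1" "y \<in> cball 0 1" "x \<noteq> y" for x y
  proof -
    define d where "d = x - y"
    have "d \<noteq> 0" using xy by (simp add: d_def)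
    define c where "c s = y + of_real s * d" for s :: real
    have c_eq: "c s = (1 - s) *\<^sub>R y + s *\<^sub>R x" for s
      by (simp add: c_def d_def scaleR_conv_of_real algebra_simps)
    have c01: "c 0 = y" "c 1 = x" by (simp_all add: c_eq)
    \<comment> \<open>Strict convexity: even when both endpoints lie on the circle, the open segment
      stays in the open disc. So monotonicity holds up to the boundary with derivatives taken only
      inside.\<close>
    have c_in: "c s \<in> unit_disc" if "0 < s" "s < 1" for s
    proof -
      have "c s \<in> open_segment y x"
        using that xy by (auto simp: in_segment c_eq)
      then show ?thesis using dist_decreases_open_segment[of "c s" y x 0] xy by auto
    qed
    have c_in': "c s \<in> cball 0 1" if "s \<in> {0..1}" for s
      using that xy convexD_alt[OF convex_cball, of y 0 1 x s] by (auto simp: c_eq)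
    have "inner (f (c 0)) d < inner (f (c 1)) d"
    proof (rule DERIV_pos_imp_increasing_open[where f = "\<lambda>s. inner (f (c s)) d"])
      have "continuous_on {0..1} c"
        unfolding c_def by (intro continuous_intros)
      then show "continuous_on {0..1} (\<lambda>s. inner (f (c s)) d)"
        using c_in' by (intro continuous_intros continuous_on_compose2[OF cont]) auto
      fix s :: real assume s: "0 < s" "s < 1"
      let ?D = "d * deriv H (c s) + cnj (d * deriv G (c s))"
      have "(c has_vector_derivative d) (at s)"
        unfolding c_def[abs_def] by (auto intro!: derivative_eq_intros simp: has_vector_derivative_def scaleR_conv_of_real)
      then have "((\<lambda>s. H (c s)) has_vector_derivative d * deriv H (c s)) (at s)"
        and "((\<lambda>s. G (c s)) has_vector_derivative d * deriv G (c s)) (at s)"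
        using field_vector_diff_chain_at[of c d s, OF _ dH[OF c_in[OF s]]]
          field_vector_diff_chain_at[of c d s, OF _ dG[OF c_in[OF s]]] by (auto simp: o_def)
      then have "((\<lambda>s. ?F (c s)) has_vector_derivative ?D) (at s)"
        unfolding harmonic_mapping_def
        by (intro has_vector_derivative_add has_vector_derivative_cnj)
      then have "((\<lambda>s. inner (?F (c s)) d) has_vector_derivative inner ?D d) (at s)"
        by (rule bounded_linear.has_vector_derivative[OF bounded_linear_inner_left])
      then have "((\<lambda>s. inner (?F (c s)) d) has_real_derivative inner ?D d) (at s)"
        by (simp add: has_real_derivative_iff_has_vector_derivative)
      then have "((\<lambda>s. inner (f (c s)) d) has_real_derivative inner ?D d) (at s)"
        by (rule has_field_derivative_transform_within_open[where S = "{0<..<1}"])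
          (use s c_in f in auto)
      moreover have "inner ?D d > 0"
      proof -
        \<comment> \<open>Multiplication by \<open>d\<close> scales and rotates both arguments
          alike, leaving only \<open>Re H'\<close>; conjugation spoils this for the \<open>G\<close>
          term, which is therefore estimated by Cauchy-Schwarz.\<close>
        have "inner (d * deriv H (c s)) d = (norm d)\<^sup>2 * Re (deriv H (c s))"
          unfolding cmod_power2 by (simp add: inner_complex_def power2_eq_square algebra_simps)
        moreover have "\<bar>inner (cnj (d * deriv G (c s))) d\<bar> \<le> (norm d)\<^sup>2 * norm (deriv G (c s))"
          using Cauchy_Schwarz_ineq2[of "cnj (d * deriv G (c s))" d]
          by (simp add: norm_mult power2_eq_square mult.commute mult.left_commute)
        moreover have "(norm d)\<^sup>2 * norm (deriv G (c s)) < (norm d)\<^sup>2 * Re (deriv H (c s))"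
          using less[OF c_in[OF s]] \<open>d \<noteq> 0\<close> by simp
        ultimately show ?thesis unfolding inner_add_left by linarith
      qed
      ultimately show "\<exists>D. ((\<lambda>s. inner (f (c s)) d) has_real_derivative D) (at s) \<and> D > 0"
        by blast
    qed simp
    then show ?thesis by (simp add: c01 d_def inner_diff_left)
  qed
  show ?thesis
    using cont mono f[symmetric] by (rule close_to_convex_if_monotone)
qed

theorem theorem6:
  fixes lam :: real and H G :: "complex \<Rightarrow> complex"
  assumes "0 < lam" and "lam \<le> 1 / 2"
    and "H \<in> class_U2 lam"
    and "G holomorphic_on unit_disc" and "G 0 = 0"
    and "dilatation H G 0 = 0"
    and "\<And>z. z \<in> unit_disc \<Longrightarrow>
           norm (dilatation H G z) \<le> sqrt ((1 - lam\<^sup>2) * (1 - 4 * lam\<^sup>2)\<^sup>2)"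
  shows "sense_preserving H G \<and> close_to_convex (harmonic_mapping H G)"
proof -
  let ?k = "sqrt ((1 - lam\<^sup>2) * (1 - 4 * lam\<^sup>2)\<^sup>2)"
  have less: "norm (deriv G z) < Re (deriv H z)" if z: "z \<in> unit_disc" for z
  proof -
    have H: "?k * norm (deriv H z) < Re (deriv H z)"
      using class_U2_deriv_bounds(1)[OF assms(3,1,2) z] .
    \<comment> \<open>Strictness rules out a zero of \<open>H'\<close>, where the dilatation would
      be 0 by the division convention and carry no information on \<open>G'\<close>.\<close>
    then have "deriv H z \<noteq> 0" by auto
    then have "norm (deriv G z) = norm (dilatation H G z) * norm (deriv H z)"
      by (simp add: dilatation_def norm_divide)
    also have "\<dots> \<le> ?k * norm (deriv H z)"
      using assms(7)[OF z] by (rule mult_right_mono) simp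
    finally show ?thesis using H by simp
  qed
  have "harmonic_jacobian H G z > 0" if "z \<in> unit_disc" for z
    using less[OF that] complex_Re_le_cmod[of "deriv H z"]
    by (auto simp: harmonic_jacobian_def intro!: power_strict_mono)
  moreover have "close_to_convex (harmonic_mapping H G)"
  proof (rule close_to_convex_harmonic_mapping)
    show "H holomorphic_on unit_disc"
      using assms(3) by (simp add: class_U2_def class_U_def class_A_def)
    show "norm (deriv H z) \<le> 6" if "z \<in> unit_disc" for z
      using class_U2_deriv_bounds(2)[OF assms(3,1,2) that] .
  qed (use assms(4) less in auto)
  ultimately show ?thesis by (simp add: sense_preserving_def)
qed

end
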